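(* Let $B$ be a Bernstein subset of $\mathbb{R}$ that is a subgroup of $(\mathbb{R},+)$, let $\mathcal{B}=\mathbb{R}/B=\{B+x:x\in\mathbb{R}\}$, and let $\mathcal{V}$ be the family of all Vitali selectors of $\mathbb{R}$. Then the families $\mathcal{N}_0*(\mathcal{S}(\mathcal{V})\vee \mathcal{S}(\mathcal{B}))$ and $(\mathcal{S}(\mathcal{V})\vee \mathcal{S}(\mathcal{B}))*\mathcal{N}_0$ are semigroups of sets on $\mathbb{R}$ satisfying $\mathcal{S}(\mathcal{V})\vee \mathcal{S}(\mathcal{B}) \subseteq \mathcal{N}_0*(\mathcal{S}(\mathcal{V})\vee \mathcal{S}(\mathcal{B})) \subseteq (\mathcal{S}(\mathcal{V})\vee \mathcal{S}(\mathcal{B}))*\mathcal{N}_0$. They are invariant under the action of the group $\Phi(\mathbb{R})$ of all translations of $\mathbb{R}$, and they consist of sets which are not Lebesgue measurable.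
   Context: A Bernstein set is a subset $B\subseteq\mathbb{R}$ such that $B\cap F\neq\emptyset$ and $(\mathbb{R}\setminus B)\cap F\neq\emptyset$ for every uncountable closed $F\subseteq\mathbb{R}$. For a countable dense subgroup $Q$ of $(\mathbb{R},+)$, a Vitali selector related to $Q$ is a set $V\subseteq\mathbb{R}$ containing exactly one element of each coset of $Q$; a Vitali selector of $\mathbb{R}$ is a Vitali selector related to some countable dense subgroup $Q$. For a non-empty family $\mathcal{A}$ of sets, $\mathcal{S}(\mathcal{A})=\{\bigcup_{i=1}^n A_i: A_i\in\mathcal{A}, n\in\mathbb{N}\}$ with $n\ge 1$. For families of sets, $\mathcal{A}\vee\mathcal{D}=\{A\cup D: A\in\mathcal{A}, D\in\mathcal{D}\}$ and $\mathcal{A}*\mathcal{D}=\{(A\setminus D_1)\cup D_2: A\in\mathcal{A}, D_1,D_2\in\mathcal{D}\}$. $\mathcal{N}_0$ is the $\sigma$-ideal of Lebesgue null subsets of $\mathbb{R}$. A semigroup of sets is a non-empty family of sets closed under finite unions. A family $\mathcal{O}$ of subsets of $\mathbb{R}$ is invariant under $\Phi(\mathbb{R})$ if $A+t\in\mathcal{O}$ for all $A\in\mathcal{O}$, $t\in\mathbb{R}$. *)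

theory Defs
  imports "HOL-Analysis.Analysis" "HOL-Algebra.Coset"
begin

definition real_add_group :: "real monoid" where
  "real_add_group = \<lparr>carrier = UNIV, monoid.mult = (+), one = 0\<rparr>"

lemma comm_group_real_add_group: "comm_group real_add_group"
  unfolding real_add_group_def
  by (rule comm_groupI) (auto intro: exI[of _ "- x" for x] simp: add_eq_0_iff)

lemma r_coset_real_add_group: "B #>\<^bsub>real_add_group\<^esub> x = (\<lambda>b. b + x) ` B"
  by (auto simp: real_add_group_def r_coset_def)

definition bernstein_set :: "real set \<Rightarrow> bool" where
  "bernstein_set B \<longleftrightarrow>
     (\<forall>F. closed F \<and> uncountable F \<longrightarrow> B \<inter> F \<noteq> {} \<and> (UNIV - B) \<inter> F \<noteq> {})"

definition vitali_selector_for :: "real set \<Rightarrow> real set \<Rightarrow> bool" where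
  "vitali_selector_for Q V \<longleftrightarrow> (\<forall>C \<in> rcosets\<^bsub>real_add_group\<^esub> Q. \<exists>!x. x \<in> V \<inter> C)"

definition vitali_selectors :: "real set set" where
  "vitali_selectors =
     {V. \<exists>Q. subgroup Q real_add_group \<and> countable Q \<and> closure Q = UNIV \<and> vitali_selector_for Q V}"

definition finite_unions :: "'a set set \<Rightarrow> 'a set set" where
  "finite_unions \<A> = {\<Union>i\<in>{1..n}. A i | (A :: nat \<Rightarrow> 'a set) n. n \<ge> 1 \<and> (\<forall>i\<in>{1..n}. A i \<in> \<A>)}"

definition family_join :: "'a set set \<Rightarrow> 'a set set \<Rightarrow> 'a set set" where
  "family_join \<A> \<D> = {A \<union> D | A D. A \<in> \<A> \<and> D \<in> \<D>}"

definition family_star :: "'a set set \<Rightarrow> 'a set set \<Rightarrow> 'a set set" where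
  "family_star \<A> \<D> = {(A - D1) \<union> D2 | A D1 D2. A \<in> \<A> \<and> D1 \<in> \<D> \<and> D2 \<in> \<D>}"

(* Closure under binary unions amounts to closure under finite non-empty unions. *)
definition semigroup_of_sets :: "'a set set \<Rightarrow> bool" where
  "semigroup_of_sets \<S> \<longleftrightarrow> \<S> \<noteq> {} \<and> (\<forall>A\<in>\<S>. \<forall>B\<in>\<S>. A \<union> B \<in> \<S>)"

definition translation_invariant :: "real set set \<Rightarrow> bool" where
  "translation_invariant \<O> \<longleftrightarrow> (\<forall>A\<in>\<O>. \<forall>t. (\<lambda>x. x + t) ` A \<in> \<O>)"

end

(*
  Let U be a finite union of Vitali selectors V_i and of cosets of B, and suppose that U is
  measurable.  The complement of U misses a coset of B, so it is null.  Since (R,+) is divisible,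
  B has infinite index.  On the other hand there is a finite set F no translate of which is covered
  by the V_i: a grid whose i-th direction is a non-zero element of the group of V_i.  Choose
  a coset C of B such that C + F misses the finitely many cosets of B in U.  As C is not null,
  some x in C satisfies x + F <= U, hence x + F is covered by the V_i, a contradiction.
*)
theory Submission
  imports Defs
begin

section \<open>Families of sets\<close>

lemma semigroup_of_setsI:
  assumes "A \<in> \<S>" "\<And>A B. A \<in> \<S> \<Longrightarrow> B \<in> \<S> \<Longrightarrow> A \<union> B \<in> \<S>"
  shows "semigroup_of_sets \<S>"
  using assms unfolding semigroup_of_sets_def by blast

lemma semigroup_of_sets_Un:
  "semigroup_of_sets \<S> \<Longrightarrow> A \<in> \<S> \<Longrightarrow> B \<in> \<S> \<Longrightarrow> A \<union> B \<in> \<S>"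
  unfolding semigroup_of_sets_def by blast

lemma family_joinI: "A \<in> \<A> \<Longrightarrow> D \<in> \<D> \<Longrightarrow> X = A \<union> D \<Longrightarrow> X \<in> family_join \<A> \<D>"
  unfolding family_join_def by blast

lemma family_joinE:
  assumes "X \<in> family_join \<A> \<D>"
  obtains A D where "A \<in> \<A>" "D \<in> \<D>" "X = A \<union> D"
  using assms unfolding family_join_def by blast

lemma family_starI:
  "A \<in> \<A> \<Longrightarrow> D \<in> \<D> \<Longrightarrow> E \<in> \<D> \<Longrightarrow> X = (A - D) \<union> E \<Longrightarrow> X \<in> family_star \<A> \<D>"
  unfolding family_star_def by blast

lemma family_starE:
  assumes "X \<in> family_star \<A> \<D>"
  obtains A D E where "A \<in> \<A>" "D \<in> \<D>" "E \<in> \<D>" "X = (A - D) \<union> E"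
  using assms unfolding family_star_def by blast

lemma translation_invariantD:
  "translation_invariant \<A> \<Longrightarrow> A \<in> \<A> \<Longrightarrow> (\<lambda>x. x + t) ` A \<in> \<A>"
  unfolding translation_invariant_def by blast

text \<open>Trades indexed unions for finite non-empty subfamilies, which can be united, mapped and
  used for induction without handling indices.\<close>

lemma finite_unions_iff:
  "X \<in> finite_unions \<A> \<longleftrightarrow> (\<exists>F. finite F \<and> F \<noteq> {} \<and> F \<subseteq> \<A> \<and> X = \<Union>F)"
proof
  assume "X \<in> finite_unions \<A>"
  then obtain A and n :: nat where "X = (\<Union>i\<in>{1..n}. A i)" "n \<ge> 1" "\<forall>i\<in>{1..n}. A i \<in> \<A>"
    unfolding finite_unions_def by blast
  then show "\<exists>F. finite F \<and> F \<noteq> {} \<and> F \<subseteq> \<A> \<and> X = \<Union>F"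
    by (intro exI[of _ "A ` {1..n}"]) auto
next
  assume "\<exists>F. finite F \<and> F \<noteq> {} \<and> F \<subseteq> \<A> \<and> X = \<Union>F"
  then obtain F where F: "finite F" "F \<noteq> {}" "F \<subseteq> \<A>" "X = \<Union>F"
    by blast
  obtain h where h: "bij_betw h {1..card F} F"
    using ex_bij_betw_nat_finite_1[OF F(1)] by blast
  have "card F \<ge> 1"
    using F by (simp add: Suc_le_eq card_gt_0_iff)
  moreover have im: "h ` {1..card F} = F"
    using h by (simp add: bij_betw_def)
  moreover have "X = (\<Union>i\<in>{1..card F}. h i)"
    using F(4) im by simp
  ultimately show "X \<in> finite_unions \<A>"
    using F(3) unfolding finite_unions_def by blast
qed

lemma semigroup_finite_unions:
  assumes "\<A> \<noteq> {}"
  shows "semigroup_of_sets (finite_unions \<A>)"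
proof -
  obtain A where "A \<in> \<A>"
    using assms by blast
  show ?thesis
  proof (rule semigroup_of_setsI)
    show "A \<in> finite_unions \<A>"
      unfolding finite_unions_iff by (rule exI[of _ "{A}"]) (simp add: \<open>A \<in> \<A>\<close>)
  next
    fix X Y assume "X \<in> finite_unions \<A>" "Y \<in> finite_unions \<A>"
    then obtain F G where "finite F" "F \<noteq> {}" "F \<subseteq> \<A>" "X = \<Union>F"
        "finite G" "G \<noteq> {}" "G \<subseteq> \<A>" "Y = \<Union>G"
      unfolding finite_unions_iff by blast
    then show "X \<union> Y \<in> finite_unions \<A>"
      unfolding finite_unions_iff by (intro exI[of _ "F \<union> G"]) auto
  qed
qed

lemma semigroup_family_join:
  assumes "semigroup_of_sets \<A>" "semigroup_of_sets \<D>"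
  shows "semigroup_of_sets (family_join \<A> \<D>)"
proof -
  obtain A D where "A \<in> \<A>" "D \<in> \<D>"
    using assms unfolding semigroup_of_sets_def by blast
  show ?thesis
  proof (rule semigroup_of_setsI)
    show "A \<union> D \<in> family_join \<A> \<D>"
      by (rule family_joinI[OF \<open>A \<in> \<A>\<close> \<open>D \<in> \<D>\<close> refl])
  next
    fix X Y assume "X \<in> family_join \<A> \<D>" "Y \<in> family_join \<A> \<D>"
    then obtain A D A' D' where *: "A \<in> \<A>" "D \<in> \<D>" "X = A \<union> D" "A' \<in> \<A>" "D' \<in> \<D>" "Y = A' \<union> D'"
      by (elim family_joinE)
    then have "X \<union> Y = (A \<union> A') \<union> (D \<union> D')"
      by blast
    then show "X \<union> Y \<in> family_join \<A> \<D>"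
      by (rule family_joinI[OF semigroup_of_sets_Un[OF assms(1) *(1,4)]
            semigroup_of_sets_Un[OF assms(2) *(2,5)]])
  qed
qed

text \<open>A hereditary family absorbs the removed set, so only the added set matters. Conversely,
  \<open>A \<union> U\<close> equals \<open>(A - U) \<union> U\<close>, so the same \<open>U\<close>
  can be both removed and added.\<close>

lemma family_star_ideal_left:
  assumes "\<And>A B. A \<in> \<N> \<Longrightarrow> B \<subseteq> A \<Longrightarrow> B \<in> \<N>"
  shows "family_star \<N> \<S> = family_join \<N> \<S>"
proof
  show "family_star \<N> \<S> \<subseteq> family_join \<N> \<S>"
  proof
    fix X assume "X \<in> family_star \<N> \<S>"
    then obtain A D E where *: "A \<in> \<N>" "D \<in> \<S>" "E \<in> \<S>" "X = (A - D) \<union> E"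
      by (rule family_starE)
    have "A - D \<in> \<N>"
      using *(1) Diff_subset by (rule assms)
    then show "X \<in> family_join \<N> \<S>"
      using *(3,4) by (rule family_joinI)
  qed
next
  show "family_join \<N> \<S> \<subseteq> family_star \<N> \<S>"
  proof
    fix X assume "X \<in> family_join \<N> \<S>"
    then obtain A U where "A \<in> \<N>" "U \<in> \<S>" "X = A \<union> U"
      by (rule family_joinE)
    then show "X \<in> family_star \<N> \<S>"
      by (intro family_starI[of A _ U _ U]) auto
  qed
qed

lemma semigroup_family_star_ideal_right:
  assumes "semigroup_of_sets \<S>" "semigroup_of_sets \<N>"
    and hered: "\<And>A B. A \<in> \<N> \<Longrightarrow> B \<subseteq> A \<Longrightarrow> B \<in> \<N>"
  shows "semigroup_of_sets (family_star \<S> \<N>)"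
proof -
  obtain A D where "A \<in> \<S>" "D \<in> \<N>"
    using assms unfolding semigroup_of_sets_def by blast
  show ?thesis
  proof (rule semigroup_of_setsI)
    show "(A - D) \<union> D \<in> family_star \<S> \<N>"
      by (rule family_starI[OF \<open>A \<in> \<S>\<close> \<open>D \<in> \<N>\<close> \<open>D \<in> \<N>\<close> refl])
  next
    fix X Y assume "X \<in> family_star \<S> \<N>" "Y \<in> family_star \<S> \<N>"
    then obtain A D E A' D' E' where
      X: "A \<in> \<S>" "D \<in> \<N>" "E \<in> \<N>" "X = (A - D) \<union> E" and
      Y: "A' \<in> \<S>" "D' \<in> \<N>" "E' \<in> \<N>" "Y = (A' - D') \<union> E'"
      by (elim family_starE)
    \<comment> \<open>The points of \<open>A \<union> A'\<close> that survive in neither difference.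
      They lie in \<open>D \<union> D'\<close>, so heredity applies; removing all of
      \<open>D \<union> D'\<close> could also delete points of \<open>A - D\<close> that belong to
      \<open>D'\<close>.\<close>
    define M where "M = (A \<union> A') - ((A - D) \<union> (A' - D'))"
    have "M \<in> \<N>"
      by (rule hered[OF semigroup_of_sets_Un[OF assms(2) X(2) Y(2)]]) (auto simp: M_def)
    moreover have "X \<union> Y = ((A \<union> A') - M) \<union> (E \<union> E')"
      unfolding M_def X Y by blast
    ultimately show "X \<union> Y \<in> family_star \<S> \<N>"
      by (rule family_starI[OF semigroup_of_sets_Un[OF assms(1) X(1) Y(1)] _
            semigroup_of_sets_Un[OF assms(2) X(3) Y(3)]])
  qed
qed

section \<open>Translation invariance of unions, joins and stars of families\<close>

lemma translation_invariant_finite_unions: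
  assumes "translation_invariant \<A>"
  shows "translation_invariant (finite_unions \<A>)"
  unfolding translation_invariant_def
proof (intro ballI allI)
  fix X t assume "X \<in> finite_unions \<A>"
  then obtain F where F: "finite F" "F \<noteq> {}" "F \<subseteq> \<A>" "X = \<Union>F"
    unfolding finite_unions_iff by blast
  show "(\<lambda>x. x + t) ` X \<in> finite_unions \<A>"
    unfolding finite_unions_iff
    using F assms by (intro exI[of _ "(`) (\<lambda>x. x + t) ` F"]) (auto simp: translation_invariant_def)
qed

lemma translation_invariant_family_join:
  assumes "translation_invariant \<A>" "translation_invariant \<D>"
  shows "translation_invariant (family_join \<A> \<D>)"
  unfolding translation_invariant_def
proof (intro ballI allI)
  fix X t assume "X \<in> family_join \<A> \<D>"
  then obtain A D where *: "A \<in> \<A>" "D \<in> \<D>" "X = A \<union> D"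
    by (rule family_joinE)
  then have "(\<lambda>x. x + t) ` X = (\<lambda>x. x + t) ` A \<union> (\<lambda>x. x + t) ` D"
    by (simp add: image_Un)
  then show "(\<lambda>x. x + t) ` X \<in> family_join \<A> \<D>"
    using translation_invariantD[OF assms(1) *(1)] translation_invariantD[OF assms(2) *(2)]
    by (metis family_joinI)
qed

lemma translation_invariant_family_star:
  assumes "translation_invariant \<A>" "translation_invariant \<D>"
  shows "translation_invariant (family_star \<A> \<D>)"
  unfolding translation_invariant_def
proof (intro ballI allI)
  fix X t assume "X \<in> family_star \<A> \<D>"
  then obtain A D E where *: "A \<in> \<A>" "D \<in> \<D>" "E \<in> \<D>" "X = (A - D) \<union> E"
    by (rule family_starE)
  let ?f = "\<lambda>x::real. x + t"
  \<comment> \<open>The image commutes with the difference because translation is injective.\<close>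
  have "?f ` X = (?f ` A - ?f ` D) \<union> ?f ` E"
    by (simp add: * image_Un image_set_diff)
  then show "?f ` X \<in> family_star \<A> \<D>"
    by (rule family_starI[OF translation_invariantD[OF assms(1) *(1)]
          translation_invariantD[OF assms(2) *(2)] translation_invariantD[OF assms(2) *(3)]])
qed

section \<open>Cosets and Vitali selectors\<close>

text \<open>The one-step subgroup test, which frees later arguments from the group record.\<close>

lemma subgroup_real_add_group_iff:
  "subgroup H real_add_group \<longleftrightarrow> 0 \<in> H \<and> (\<forall>x\<in>H. \<forall>y\<in>H. x - y \<in> H)"
proof -
  interpret comm_group real_add_group
    by (rule comm_group_real_add_group)
  have inv: "inv\<^bsub>real_add_group\<^esub> x = - x" for x
    by (rule inv_equality) (auto simp: real_add_group_def)
  show ?thesis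
  proof
    assume H: "subgroup H real_add_group"
    have "x - y \<in> H" if "x \<in> H" "y \<in> H" for x y
      using subgroup.m_closed[OF H that(1) subgroup.m_inv_closed[OF H that(2)]]
      unfolding inv by (simp add: real_add_group_def)
    then show "0 \<in> H \<and> (\<forall>x\<in>H. \<forall>y\<in>H. x - y \<in> H)"
      using subgroup.one_closed[OF H] by (simp add: real_add_group_def)
  next
    assume H: "0 \<in> H \<and> (\<forall>x\<in>H. \<forall>y\<in>H. x - y \<in> H)"
    then have neg: "- x \<in> H" if "x \<in> H" for x
      using that by (metis diff_0)
    have "x + y \<in> H" if "x \<in> H" "y \<in> H" for x y
      using H neg[OF that(2)] that(1) by (metis diff_minus_eq_add)
    then show "subgroup H real_add_group"
      using H neg by (intro subgroup.intro) (auto simp: inv, auto simp: real_add_group_def)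
  qed
qed

lemma subgroup_real_of_nat_mult:
  assumes "subgroup H real_add_group" "x \<in> H"
  shows "real n * x \<in> H"
proof (induction n)
  case 0
  then show ?case
    using assms by (simp add: subgroup_real_add_group_iff)
next
  case (Suc n)
  have "real (Suc n) * x = real n * x - (0 - x)"
    by (simp add: algebra_simps)
  then show ?case
    using Suc assms unfolding subgroup_real_add_group_iff by metis
qed

text \<open>Membership in a coset becomes a condition on a difference, which suits translations and
  the uniqueness condition for selectors.\<close>

lemma rcosets_real_add_group: "rcosets\<^bsub>real_add_group\<^esub> B = (\<lambda>x. {y. y - x \<in> B}) ` UNIV"
proof -
  have "(\<lambda>b. b + x) ` B = {y. y - x \<in> B}" for x
  proof (intro equalityI subsetI)
    fix y assume "y \<in> {y. y - x \<in> B}"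
    then show "y \<in> (\<lambda>b. b + x) ` B"
      by (intro image_eqI[of _ _ "y - x"]) simp_all
  qed auto
  moreover have "rcosets\<^bsub>real_add_group\<^esub> B = (\<lambda>x. (\<lambda>b. b + x) ` B) ` UNIV"
    unfolding RCOSETS_def r_coset_real_add_group by (auto simp: real_add_group_def)
  ultimately show ?thesis
    by simp
qed

lemma translation_invariant_rcosets:
  "translation_invariant (rcosets\<^bsub>real_add_group\<^esub> B)"
proof -
  have "(\<lambda>x. x + t) ` {y. y - x \<in> B} = {y. y - (x + t) \<in> B}" for x t
  proof (intro equalityI subsetI)
    fix y assume "y \<in> {y. y - (x + t) \<in> B}"
    then show "y \<in> (\<lambda>x. x + t) ` {y. y - x \<in> B}"
      by (intro image_eqI[of _ _ "y - t"]) (simp_all add: diff_diff_eq add.commute)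
  qed auto
  then show ?thesis
    unfolding translation_invariant_def rcosets_real_add_group by blast
qed

lemma vitali_selector_for_iff:
  "vitali_selector_for Q V \<longleftrightarrow> (\<forall>a. \<exists>!x. x \<in> V \<and> x - a \<in> Q)"
  unfolding vitali_selector_for_def rcosets_real_add_group by simp

text \<open>The axiom of choice yields a selector for the group of rationals.\<close>

lemma vitali_selectors_nonempty: "vitali_selectors \<noteq> {}"
proof -
  define s :: "real \<Rightarrow> real" where "s a = (SOME x. x - a \<in> \<rat>)" for a
  have s: "s a - a \<in> \<rat>" for a
    unfolding s_def by (rule someI[of _ a]) simp
  \<comment> \<open>The choice depends only on the coset: congruent \<open>a\<close> and
    \<open>b\<close> hand the same predicate to \<open>SOME\<close>.\<close>
  have s_cong: "s a = s b" if "a - b \<in> \<rat>" for a b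
  proof -
    have "x - a \<in> \<rat> \<longleftrightarrow> x - b \<in> \<rat>" for x
      using Rats_add[OF _ that, of "x - a"] Rats_diff[OF _ that, of "x - b"] by auto
    then show ?thesis
      unfolding s_def by simp
  qed
  have "\<exists>!x. x \<in> range s \<and> x - a \<in> \<rat>" for a
  proof (rule ex1I[of _ "s a"])
    show "s a \<in> range s \<and> s a - a \<in> \<rat>"
      using s by blast
  next
    fix x assume "x \<in> range s \<and> x - a \<in> \<rat>"
    then obtain b where b: "x = s b" "s b - a \<in> \<rat>"
      by blast
    then have "b - a \<in> \<rat>"
      using Rats_diff[OF b(2) s[of b]] by simp
    then show "x = s a"
      using s_cong b(1) by simp
  qed
  then have "vitali_selector_for \<rat> (range s)"
    unfolding vitali_selector_for_iff by blast
  moreover have "subgroup \<rat> real_add_group"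
    unfolding subgroup_real_add_group_iff by simp
  ultimately have "range s \<in> vitali_selectors"
    unfolding vitali_selectors_def using countable_rat Rats_closure_real by blast
  then show ?thesis
    by blast
qed

lemma translation_invariant_vitali_selectors: "translation_invariant vitali_selectors"
  unfolding translation_invariant_def
proof (intro ballI allI)
  fix V t assume "V \<in> vitali_selectors"
  then obtain Q where Q: "subgroup Q real_add_group" "countable Q" "closure Q = UNIV"
      and V: "vitali_selector_for Q V"
    unfolding vitali_selectors_def by blast
  have "\<exists>!x. x \<in> (\<lambda>x. x + t) ` V \<and> x - a \<in> Q" for a
  proof -
    \<comment> \<open>The point of the translated selector in the coset of \<open>a\<close> is the
      point of \<open>V\<close> in the coset of \<open>a - t\<close>, shifted by
      \<open>t\<close>.\<close>
    obtain x where x: "x \<in> V" "x - (a - t) \<in> Q" "\<And>y. y \<in> V \<Longrightarrow> y - (a - t) \<in> Q \<Longrightarrow> y = x"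
      using V unfolding vitali_selector_for_iff by metis
    show ?thesis
    proof (rule ex1I[of _ "x + t"])
      show "x + t \<in> (\<lambda>x. x + t) ` V \<and> x + t - a \<in> Q"
        using x(1,2) by (simp add: diff_diff_eq2)
    next
      fix y assume "y \<in> (\<lambda>x. x + t) ` V \<and> y - a \<in> Q"
      then obtain v where "v \<in> V" "y = v + t" "v + t - a \<in> Q"
        by blast
      then show "y = x + t"
        using x(3)[of v] by (simp add: diff_diff_eq2)
    qed
  qed
  then have "vitali_selector_for Q ((\<lambda>x. x + t) ` V)"
    unfolding vitali_selector_for_iff by blast
  then show "(\<lambda>x. x + t) ` V \<in> vitali_selectors"
    using Q unfolding vitali_selectors_def by blast
qed

section \<open>Finite patterns that finitely many Vitali selectors cannot cover\<close>

text \<open>A dense subgroup has a non-zero element \<open>q\<close>. All points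
  \<open>x + j * q\<close> lie in one coset of the subgroup, and the selector has just one point
  there.\<close>

lemma vitali_selector_direction:
  assumes "V \<in> vitali_selectors"
  obtains q :: real where "\<And>x y j k::nat. x + real j * q \<in> V \<Longrightarrow> x + real k * q \<in> V \<Longrightarrow> j = k"
proof -
  obtain Q where Q: "subgroup Q real_add_group" "closure Q = UNIV" "vitali_selector_for Q V"
    using assms unfolding vitali_selectors_def by blast
  have "\<not> Q \<subseteq> {0}"
  proof
    assume "Q \<subseteq> {0}"
    then have "closure Q \<subseteq> {0}"
      by (metis closure_minimal closed_singleton)
    then have "(1::real) \<in> {0}"
      unfolding Q(2) by blast
    then show False
      by simp
  qed
  then obtain q where q: "q \<in> Q" "q \<noteq> 0"
    by blast
  have "j = k" if "x + real j * q \<in> V" "x + real k * q \<in> V" for x and j k :: nat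
  proof -
    have "real n * q \<in> Q" for n
      using Q(1) q(1) by (rule subgroup_real_of_nat_mult)
    then have "x + real j * q = x + real k * q"
      using Q(3) that unfolding vitali_selector_for_iff by (metis add_diff_cancel_left')
    then show ?thesis
      using q by simp
  qed
  then show thesis
    by (rule that)
qed

text \<open>Induction on the number of selectors: for a new selector with direction \<open>q\<close>, stack
  \<open>card F + 1\<close> copies of the old set \<open>F\<close> along \<open>q\<close>. If every copy met the new selector, two of them
  would do so at the same point of \<open>F\<close>, by the pigeonhole principle.\<close>
lemma finite_pattern_avoiding_vitali_selectors:
  assumes "finite \<F>" "\<F> \<subseteq> vitali_selectors"
  shows "\<exists>F. finite F \<and> (\<forall>x. \<exists>f\<in>F. x + f \<notin> \<Union>\<F>)"
  using assms
proof (induction \<F> rule: finite_induct)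
  case empty
  show ?case
    by (rule exI[of _ "{0}"]) simp
next
  case (insert V \<F>)
  then obtain F where F: "finite F" "\<And>x. \<exists>f\<in>F. x + f \<notin> \<Union>\<F>"
    by auto
  obtain q where q: "\<And>x j k::nat. x + real j * q \<in> V \<Longrightarrow> x + real k * q \<in> V \<Longrightarrow> j = k"
    using vitali_selector_direction insert.prems by (metis insert_subset)
  define G where "G = (\<lambda>(k, f). f + real k * q) ` ({..card F} \<times> F)"
  have "\<exists>g\<in>G. x + g \<notin> \<Union>(insert V \<F>)" for x
  proof (rule ccontr)
    assume contra: "\<not> (\<exists>g\<in>G. x + g \<notin> \<Union>(insert V \<F>))"
    \<comment> \<open>In the \<open>k\<close>-th copy, \<open>h k\<close> marks a point that escapes
      all old selectors.\<close>
    have "\<forall>k. \<exists>f. f \<in> F \<and> (x + real k * q) + f \<notin> \<Union>\<F>"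
      using F(2) by blast
    then obtain h where h: "\<And>k. h k \<in> F" "\<And>k. (x + real k * q) + h k \<notin> \<Union>\<F>"
      by metis
    have "card (h ` {..card F}) < card {..card F}"
      using card_mono[OF F(1), of "h ` {..card F}"] h(1)
      by (simp add: image_subset_iff less_Suc_eq_le)
    then have "\<not> inj_on h {..card F}"
      by (rule pigeonhole)
    then obtain j k where jk: "j \<le> card F" "k \<le> card F" "j \<noteq> k" "h j = h k"
      unfolding inj_on_def by auto
    \<comment> \<open>By assumption all of \<open>x + G\<close> is covered, so a point outside the
      old selectors must lie in \<open>V\<close>.\<close>
    have "(x + h i) + real i * q \<in> V" if "i \<le> card F" for i
    proof -
      have "h i + real i * q \<in> G"
        unfolding G_def using that h(1) by force
      then have "x + (h i + real i * q) \<in> \<Union>(insert V \<F>)"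
        using contra by blast
      then show ?thesis
        using h(2)[of i] by (auto simp: algebra_simps)
    qed
    then show False
      using q[of "x + h j" j k] jk by metis
  qed
  moreover have "finite G"
    unfolding G_def using F(1) by simp
  ultimately show ?case
    by blast
qed

section \<open>Subgroups of finite index in the real line\<close>

text \<open>Divisibility of the reals: \<open>r\<close> is \<open>N\<close> times
  \<open>r / N\<close>. Among the multiples of \<open>r / N\<close> by 0, ...,
  \<open>card J\<close>, two are congruent modulo \<open>B\<close>, so \<open>m * (r / N)\<close>
  lies in \<open>B\<close> for some \<open>m\<close> from 1 to \<open>card J\<close>. If
  \<open>m\<close> divides \<open>N\<close>, a further multiple of this element is
  \<open>r\<close>.\<close>

lemma finite_index_subgroup_real_eq_UNIV:
  assumes B: "subgroup B real_add_group" and "finite J" and cover: "\<And>y. \<exists>x\<in>J. y - x \<in> B"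
  shows "B = UNIV"
proof -
  have diff: "x - y \<in> B" if "x \<in> B" "y \<in> B" for x y
    using B that unfolding subgroup_real_add_group_iff by blast
  have "r \<in> B" for r
  proof -
    \<comment> \<open>A factorial is divisible by whichever gap \<open>k - j\<close> the pigeonhole
      principle yields.\<close>
    define N :: real where "N = fact (card J)"
    have "\<forall>k::nat. \<exists>x. x \<in> J \<and> real k * (r / N) - x \<in> B"
      using cover by blast
    then obtain h where h: "\<And>k. h k \<in> J" "\<And>k::nat. real k * (r / N) - h k \<in> B"
      by metis
    have "card (h ` {..card J}) < card {..card J}"
      using card_mono[OF \<open>finite J\<close>, of "h ` {..card J}"] h(1)
      by (simp add: image_subset_iff less_Suc_eq_le)
    then have "\<not> inj_on h {..card J}"
      by (rule pigeonhole)
    then have "\<exists>j k. j < k \<and> k \<le> card J \<and> h j = h k"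
      unfolding inj_on_def by (metis atMost_iff linorder_neqE_nat)
    then obtain j k where jk: "j < k" "k \<le> card J" "h j = h k"
      by blast
    have "real (k - j) * (r / N) = (real k * (r / N) - h k) - (real j * (r / N) - h j)"
      using jk by (simp add: of_nat_diff algebra_simps)
    then have mem: "real (k - j) * (r / N) \<in> B"
      using diff h(2) by metis
    have "(k - j) dvd fact (card J)"
      using jk by (intro dvd_fact) auto
    then obtain c where c: "fact (card J) = (k - j) * c"
      by (auto simp: dvd_def)
    then have N: "N = real (k - j) * real c"
      unfolding N_def by (metis of_nat_fact of_nat_mult)
    have "N \<noteq> 0"
      unfolding N_def by simp
    then have "real c * (real (k - j) * (r / N)) = r"
      unfolding N by (simp add: field_simps)
    then show ?thesis
      using subgroup_real_of_nat_mult[OF B mem, of c] by simp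
  qed
  then show ?thesis
    by blast
qed

section \<open>Measurability\<close>

text \<open>Inner regularity: \<open>S\<close> exceeds some closed subset by arbitrarily small
  measure, and that subset is countable, hence null.\<close>

lemma negligible_if_closed_subsets_countable:
  fixes S :: "'a::euclidean_space set"
  assumes S: "S \<in> sets lebesgue" and countable: "\<And>F. closed F \<Longrightarrow> F \<subseteq> S \<Longrightarrow> countable F"
  shows "negligible S"
proof -
  have "emeasure lebesgue S \<le> 0 + ennreal e" if "e > 0" for e
  proof -
    obtain T where T: "closed T" "T \<subseteq> S" "S - T \<in> lmeasurable" "emeasure lebesgue (S - T) < ennreal e"
      using sets_lebesgue_inner_closed[OF S \<open>e > 0\<close>] by blast
    have "T \<in> null_sets lebesgue"
      using countable[OF T(1,2)] countable_imp_null_set_lborel null_sets_completionI by blast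
    then have "emeasure lebesgue (S - T) = emeasure lebesgue S"
      using S by (intro emeasure_Diff_null_set)
    then show ?thesis
      using T(4) by simp
  qed
  then have "emeasure lebesgue S \<le> 0"
    by (rule ennreal_le_epsilon)
  then show ?thesis
    using S by (simp add: negligible_iff_null_sets null_setsI)
qed

text \<open>\<open>B\<close> meets every uncountable closed set, so the closed subsets of a set
  disjoint from \<open>B\<close> are countable.\<close>

lemma bernstein_disjoint_negligible:
  assumes "bernstein_set B" "S \<in> sets lebesgue" "B \<inter> S = {}"
  shows "negligible S"
  using assms(1,3) unfolding bernstein_set_def
  by (intro negligible_if_closed_subsets_countable[OF assms(2)]) blast

text \<open>Translation by \<open>- x\<close> carries the coset to \<open>B\<close> and preserves
  both measurability and nullity.\<close>

lemma bernstein_coset_disjoint_negligible: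
  assumes "bernstein_set B" "S \<in> sets lebesgue" "{y. y - x \<in> B} \<inter> S = {}"
  shows "negligible S"
proof -
  have "B \<inter> (+) (- x) ` S = {}"
    using assms(3) by (auto simp: algebra_simps)
  then have "negligible ((+) (- x) ` S)"
    using bernstein_disjoint_negligible[OF assms(1) lebesgue_sets_translation[OF assms(2)]] by blast
  then show ?thesis
    by (rule negligible_translation_rev)
qed

text \<open>A null coset would have a measurable complement, which is disjoint from the coset and
  hence null as well; the whole line would then be null.\<close>

lemma bernstein_coset_not_negligible:
  assumes "bernstein_set B"
  shows "\<not> negligible {y. y - x \<in> B}"
proof
  let ?C = "{y. y - x \<in> B}"
  assume C: "negligible ?C"
  then have "- ?C \<in> sets lebesgue"
    by (meson Compl_in_sets_lebesgue negligible_imp_sets)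
  then have "negligible (- ?C)"
    by (rule bernstein_coset_disjoint_negligible[OF assms]) blast
  then have "negligible (?C \<union> - ?C)"
    using C by (rule negligible_Un[rotated])
  then show False
    by simp
qed

section \<open>Non-measurability of unions of selectors and cosets\<close>

lemma vitali_join_bernstein_cosets_not_measurable:
  assumes B: "bernstein_set B" "subgroup B real_add_group"
    and U: "U \<in> family_join (finite_unions vitali_selectors) (finite_unions (rcosets\<^bsub>real_add_group\<^esub> B))"
  shows "U \<notin> sets lebesgue"
proof
  assume meas: "U \<in> sets lebesgue"
  obtain \<F> \<G> where \<F>: "finite \<F>" "\<F> \<subseteq> vitali_selectors"
    and \<G>: "finite \<G>" "\<G> \<noteq> {}" "\<G> \<subseteq> rcosets\<^bsub>real_add_group\<^esub> B" and U_eq: "U = \<Union>\<F> \<union> \<Union>\<G>"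
    using U unfolding family_join_def finite_unions_iff by blast
  obtain J where J: "finite J" "\<G> = (\<lambda>x. {y. y - x \<in> B}) ` J"
    using finite_subset_image[OF \<G>(1)] \<G>(3) unfolding rcosets_real_add_group by metis
  then obtain x\<^sub>0 where x\<^sub>0: "x\<^sub>0 \<in> J"
    using \<G>(2) by blast
  have null: "negligible (- U)"
  proof (rule bernstein_coset_disjoint_negligible[OF B(1)])
    show "- U \<in> sets lebesgue"
      using meas by (simp add: Compl_in_sets_lebesgue)
    show "{y. y - x\<^sub>0 \<in> B} \<inter> - U = {}"
      using x\<^sub>0 J(2) U_eq by blast
  qed
  obtain F where F: "finite F" "\<And>x. \<exists>f\<in>F. x + f \<notin> \<Union>\<F>"
    using finite_pattern_avoiding_vitali_selectors[OF \<F>] by blast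
  \<comment> \<open>The line itself is closed and uncountable, so it meets the complement of
    \<open>B\<close>.\<close>
  have "B \<noteq> UNIV"
    using B(1) uncountable_UNIV_real unfolding bernstein_set_def by auto
  moreover have "finite ((\<lambda>(x, f). x - f) ` (J \<times> F))"
    using J(1) F(1) by simp
  \<comment> \<open>Without such a \<open>y\<close>, the finitely many differences
    \<open>x - f\<close> would represent all cosets of \<open>B\<close>. The choice ensures that
    \<open>y + f\<close> lies in none of the cosets given by \<open>J\<close>, for any
    \<open>f\<close> in \<open>F\<close>.\<close>
  ultimately obtain y where "\<And>z. z \<in> (\<lambda>(x, f). x - f) ` (J \<times> F) \<Longrightarrow> y - z \<notin> B"
    using finite_index_subgroup_real_eq_UNIV[OF B(2)] by metis
  then have y: "y - (x - f) \<notin> B" if "x \<in> J" "f \<in> F" for x f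
    using that by force
  \<comment> \<open>These are the points that some \<open>f\<close> in \<open>F\<close> moves out of
    \<open>U\<close>. Finitely many translates of a null set cannot contain the coset of
    \<open>y\<close>.\<close>
  have "negligible (\<Union>f\<in>F. (+) (- f) ` (- U))"
  proof (rule negligible_Union)
    show "finite ((\<lambda>f. (+) (- f) ` (- U)) ` F)"
      using F(1) by simp
    show "negligible T" if "T \<in> (\<lambda>f. (+) (- f) ` (- U)) ` F" for T
      using that negligible_translation[OF null] by blast
  qed
  then have "\<not> {x. x - y \<in> B} \<subseteq> (\<Union>f\<in>F. (+) (- f) ` (- U))"
    using bernstein_coset_not_negligible[OF B(1)] negligible_subset by blast
  then obtain x where x: "x - y \<in> B" "x \<notin> (\<Union>f\<in>F. (+) (- f) ` (- U))"
    by blast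
  obtain f where f: "f \<in> F" "x + f \<notin> \<Union>\<F>"
    using F(2) by blast
  have "x + f \<in> U"
  proof (rule ccontr)
    assume "x + f \<notin> U"
    then have "x \<in> (+) (- f) ` (- U)"
      by (intro image_eqI[of _ _ "x + f"]) auto
    then show False
      using x(2) f(1) by blast
  qed
  then obtain z where z: "z \<in> J" "x + f - z \<in> B"
    using f(2) U_eq J(2) by auto
  \<comment> \<open>The difference equals \<open>y - (z - f)\<close>, which the choice of
    \<open>y\<close> keeps out of \<open>B\<close>.\<close>
  have "(x + f - z) - (x - y) \<in> B"
    using B(2) z(2) x(1) unfolding subgroup_real_add_group_iff by blast
  then show False
    using y[OF z(1) f(1)] by (simp add: algebra_simps)
qed

lemma translation_invariant_null_sets: "translation_invariant (null_sets lebesgue)"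
  unfolding translation_invariant_def
proof (intro ballI allI)
  fix S :: "real set" and t :: real assume "S \<in> null_sets lebesgue"
  then have "negligible ((+) t ` S)"
    using negligible_translation negligible_iff_null_sets by blast
  moreover have "(+) t ` S = (\<lambda>x. x + t) ` S"
    by (intro image_cong) simp_all
  ultimately show "(\<lambda>x. x + t) ` S \<in> null_sets lebesgue"
    using negligible_iff_null_sets by metis
qed

theorem theorem5p4:
  fixes B :: "real set" and \<B> \<V> \<N>\<^sub>0 \<S> :: "real set set"
  assumes "bernstein_set B"
    and "subgroup B real_add_group"
  defines "\<B> \<equiv> rcosets\<^bsub>real_add_group\<^esub> B"
    and "\<V> \<equiv> vitali_selectors"
    and "\<N>\<^sub>0 \<equiv> null_sets lebesgue"
    and "\<S> \<equiv> family_join (finite_unions \<V>) (finite_unions \<B>)"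
  shows "semigroup_of_sets (family_star \<N>\<^sub>0 \<S>)
       \<and> semigroup_of_sets (family_star \<S> \<N>\<^sub>0)
       \<and> \<S> \<subseteq> family_star \<N>\<^sub>0 \<S>
       \<and> family_star \<N>\<^sub>0 \<S> \<subseteq> family_star \<S> \<N>\<^sub>0
       \<and> translation_invariant (family_star \<N>\<^sub>0 \<S>)
       \<and> translation_invariant (family_star \<S> \<N>\<^sub>0)
       \<and> (\<forall>A \<in> family_star \<N>\<^sub>0 \<S>. A \<notin> sets lebesgue)
       \<and> (\<forall>A \<in> family_star \<S> \<N>\<^sub>0. A \<notin> sets lebesgue)"
proof -
  \<comment> \<open>Completeness of Lebesgue measure: every subset of a null set is measurable and
    null.\<close>
  have hered: "A' \<in> \<N>\<^sub>0" if "A \<in> \<N>\<^sub>0" "A' \<subseteq> A" for A A'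
    using that null_sets_completion_subset unfolding \<N>\<^sub>0_def by blast
  have empty: "{} \<in> \<N>\<^sub>0"
    unfolding \<N>\<^sub>0_def by simp
  have semi_N: "semigroup_of_sets \<N>\<^sub>0"
    using empty by (rule semigroup_of_setsI) (simp add: \<N>\<^sub>0_def null_sets.Un)
  have "\<B> \<noteq> {}"
    unfolding \<B>_def rcosets_real_add_group by simp
  then have semi_S: "semigroup_of_sets \<S>"
    unfolding \<S>_def \<V>_def
    by (intro semigroup_family_join semigroup_finite_unions vitali_selectors_nonempty)
  have inv_S: "translation_invariant \<S>"
    unfolding \<S>_def \<V>_def \<B>_def
    by (intro translation_invariant_family_join translation_invariant_finite_unions
        translation_invariant_vitali_selectors translation_invariant_rcosets)
  have inv_N: "translation_invariant \<N>\<^sub>0"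
    unfolding \<N>\<^sub>0_def by (rule translation_invariant_null_sets)
  have left: "family_star \<N>\<^sub>0 \<S> = family_join \<N>\<^sub>0 \<S>"
    using hered by (rule family_star_ideal_left)
  have sub1: "\<S> \<subseteq> family_star \<N>\<^sub>0 \<S>"
    unfolding left by (auto intro: family_joinI[OF empty])
  have sub2: "family_star \<N>\<^sub>0 \<S> \<subseteq> family_star \<S> \<N>\<^sub>0"
  proof
    fix X assume "X \<in> family_star \<N>\<^sub>0 \<S>"
    then obtain M U where "M \<in> \<N>\<^sub>0" "U \<in> \<S>" "X = M \<union> U"
      unfolding left by (rule family_joinE)
    \<comment> \<open>The empty set is null, so \<open>M\<close> is added to \<open>U\<close> with
      nothing removed.\<close>
    then show "X \<in> family_star \<S> \<N>\<^sub>0"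
      by (intro family_starI[of U _ "{}" _ M]) (auto simp: empty)
  qed
  \<comment> \<open>The larger family suffices, since \<open>sub2\<close> passes the result on to
    the smaller one.\<close>
  have nonmeas: "X \<notin> sets lebesgue" if X_in: "X \<in> family_star \<S> \<N>\<^sub>0" for X
  proof
    assume X: "X \<in> sets lebesgue"
    obtain U D E where U: "U \<in> \<S>" "D \<in> \<N>\<^sub>0" "E \<in> \<N>\<^sub>0" "X = (U - D) \<union> E"
      by (rule family_starE[OF X_in])
    \<comment> \<open>These are the null sets that \<open>X\<close> gains and loses relative to
      \<open>U\<close>. Undoing both changes would make \<open>U\<close> measurable.\<close>
    have "E - U \<in> \<N>\<^sub>0" "U \<inter> D \<in> \<N>\<^sub>0"
      using hered[OF U(3), of "E - U"] hered[OF U(2), of "U \<inter> D"] by auto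
    then have "(X - (E - U)) \<union> (U \<inter> D) \<in> sets lebesgue"
      using X unfolding \<N>\<^sub>0_def by (simp add: null_setsD2 sets.Un sets.Diff)
    also have "(X - (E - U)) \<union> (U \<inter> D) = U"
      unfolding U(4) by blast
    finally show False
      using vitali_join_bernstein_cosets_not_measurable[OF assms(1,2)] U(1)
      unfolding \<S>_def \<V>_def \<B>_def by blast
  qed
  have semi_right: "semigroup_of_sets (family_star \<S> \<N>\<^sub>0)"
    using semi_S semi_N hered by (rule semigroup_family_star_ideal_right)
  show ?thesis
    using semigroup_family_join[OF semi_N semi_S] semi_right sub1 sub2 translation_invariant_family_star[OF inv_N inv_S]
      translation_invariant_family_star[OF inv_S inv_N] nonmeas
    unfolding left by blast
qed

end
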